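(* Let $M \ge 2$, $N \ge 1$, $p \ge 0$ be integers such that $\operatorname{rad}(M) \nmid \operatorname{rad}(N)$, and let $\xi$ be a primitive $M$-th root of unity. Define the polynomial $G_p(z) := \sum_{m=0}^{M^{p+1}-1} \xi^{\mathcal{B}_{M,N}(m)} z^m$. Then $z=1$ is a root of $G_p(z)$ of multiplicity at least $p+1$, i.e. $G_p^{(j)}(1) = 0$ for all integers $0 \le j \le p$.
   Context: For integers $M\ge 2$, $N \ge 1$ and $n\ge 0$ with base-$M$ expansion $n=\sum_{i\ge 0} d_i(n) M^i$, $d_i(n)\in\{0,\dots,M-1\}$, the base-shifting map is $\mathcal{B}_{M,N}(n) := \sum_{i\ge 0} d_i(n) N^i$. $\operatorname{rad}(k)$ is the product of the distinct prime factors of $k$. *)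

theory Defs
  imports Complex_Main "HOL-Computational_Algebra.Computational_Algebra"
begin

definition rad :: "nat \<Rightarrow> nat" where
  "rad k = \<Prod>(prime_factors k)"

definition digit :: "nat \<Rightarrow> nat \<Rightarrow> nat \<Rightarrow> nat" where
  "digit M i n = n div M ^ i mod M"

lemma finite_digit_support:
  assumes "M \<ge> 2"
  shows "finite {i. digit M i n \<noteq> 0}"
proof (rule finite_subset)
  show "{i. digit M i n \<noteq> 0} \<subseteq> {..n}"
  proof
    fix i assume i: "i \<in> {i. digit M i n \<noteq> 0}"
    have "i < M ^ i"
      using assms by (simp add: power_gt_expt)
    moreover have "M ^ i \<le> n"
      using i by (cases "n < M ^ i") (auto simp: digit_def)
    ultimately show "i \<in> {..n}" by simp
  qed
qed simp

(* The sum over all i >= 0 is written as the sum over the support of the digits, which is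
   finite for M >= 2. *)
definition base_shift :: "nat \<Rightarrow> nat \<Rightarrow> nat \<Rightarrow> nat" where
  "base_shift M N n = (\<Sum>i \<in> {i. digit M i n \<noteq> 0}. digit M i n * N ^ i)"

definition primitive_root_of_unity :: "nat \<Rightarrow> complex \<Rightarrow> bool" where
  "primitive_root_of_unity M \<xi> \<longleftrightarrow> M > 0 \<and> \<xi> ^ M = 1 \<and> (\<forall>k. 0 < k \<and> k < M \<longrightarrow> \<xi> ^ k \<noteq> 1)"

definition G_poly :: "nat \<Rightarrow> nat \<Rightarrow> complex \<Rightarrow> nat \<Rightarrow> complex poly" where
  "G_poly M N \<xi> p = (\<Sum>m < M ^ (p + 1). monom (\<xi> ^ base_shift M N m) m)"

(* The root multiplicity order a q is meaningful only for q not 0. *)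
lemma G_poly_nonzero:
  assumes "M \<ge> 2"
  shows "G_poly M N \<xi> p \<noteq> 0"
proof -
  have "coeff (G_poly M N \<xi> p) 0 = (\<Sum>m < M ^ (p + 1). if m = 0 then \<xi> ^ base_shift M N m else 0)"
    by (simp add: G_poly_def coeff_sum)
  also have "\<dots> = \<xi> ^ base_shift M N 0"
    using assms by (simp add: sum.delta)
  also have "\<dots> = 1"
    by (simp add: base_shift_def digit_def)
  finally show ?thesis by auto
qed

end

theory Submission
  imports Defs
begin

text \<open>
  Since the base-shifting map is additive over digits, \<open>G_poly M N \<xi> p\<close> is the product over
  \<open>i \<le> p\<close> of \<open>\<Sum>d<M. \<xi> ^ (d * N ^ i) * z ^ (d * M ^ i)\<close>. At \<open>z = 1\<close> each factor is a geometric sum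
  in \<open>\<xi> ^ (N ^ i)\<close>, which is an \<open>M\<close>-th root of unity different from 1: otherwise \<open>M dvd N ^ i\<close>, and
  every prime factor of \<open>M\<close> would divide \<open>N\<close>.
\<close>

text \<open>A prime dividing \<open>M\<close> divides \<open>N ^ i\<close>, hence \<open>N\<close>;
  as \<open>N\<close> is nonzero, it is among the prime factors of \<open>N\<close>.\<close>

lemma rad_dvd_rad_if_dvd_power:
  assumes "M dvd N ^ i" and "N \<ge> 1"
  shows "rad M dvd rad N"
proof -
  have "prime_factors M \<subseteq> prime_factors N"
    using assms by (auto simp: in_prime_factors_iff) (metis dvd_trans prime_dvd_power)
  then show ?thesis
    unfolding rad_def by (intro prod_dvd_prod_subset) auto
qed

text \<open>Reducing the exponent modulo \<open>M\<close> leaves one below \<open>M\<close>, which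
  minimality of the order forces to be 0.\<close>

lemma primitive_root_of_unity_power_eq_1_iff:
  assumes "primitive_root_of_unity M \<xi>"
  shows "\<xi> ^ n = 1 \<longleftrightarrow> M dvd n"
proof
  have M: "M > 0" "\<xi> ^ M = 1" and least: "\<And>k. 0 < k \<Longrightarrow> k < M \<Longrightarrow> \<xi> ^ k \<noteq> 1"
    using assms by (auto simp: primitive_root_of_unity_def)
  assume "\<xi> ^ n = 1"
  moreover have "\<xi> ^ n = \<xi> ^ (M * (n div M) + n mod M)"
    by simp
  ultimately have "\<xi> ^ (n mod M) = 1"
    using M by (simp only: power_add power_mult) simp
  then show "M dvd n"
    using least[of "n mod M"] M by (auto simp: dvd_eq_mod_eq_0)
next
  assume "M dvd n"
  then show "\<xi> ^ n = 1"
    using assms by (auto simp: primitive_root_of_unity_def power_mult)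
qed

text \<open>Trades the support, which varies with \<open>n\<close>, for a fixed index range, so that
  values at different arguments can be compared term by term.\<close>

lemma base_shift_eq_sum_lessThan:
  assumes "M > 0" and "n < M ^ k"
  shows "base_shift M N n = (\<Sum>i<k. digit M i n * N ^ i)"
  unfolding base_shift_def
proof (rule sum.mono_neutral_left)
  have "digit M i n = 0" if "k \<le> i" for i
    using assms power_increasing[OF that, of M] by (simp add: digit_def)
  then show "{i. digit M i n \<noteq> 0} \<subseteq> {..<k}"
    by (metis (mono_tags, lifting) lessThan_iff mem_Collect_eq not_less subsetI)
qed auto

text \<open>The digit \<open>d\<close> lands in position \<open>k\<close>, which is free in
  \<open>m\<close>, so no carry occurs.\<close>

lemma base_shift_add_mult_power:
  assumes "m < M ^ k" and "d < M"
  shows "base_shift M N (m + d * M ^ k) = base_shift M N m + d * N ^ k"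
proof -
  have "m + d * M ^ k < (d + 1) * M ^ k"
    using assms by simp
  also have "\<dots> \<le> M * M ^ k"
    using assms by (intro mult_right_mono) auto
  finally have "m + d * M ^ k < M ^ Suc k"
    by simp
  moreover have "digit M i (m + d * M ^ k) = digit M i m" if "i < k" for i
  proof -
    \<comment> \<open>One factor \<open>M\<close> is kept apart: after division by
      \<open>M ^ i\<close> the added term is still a multiple of \<open>M\<close> and vanishes
      modulo \<open>M\<close>.\<close>
    have "M ^ k = M ^ i * (M * M ^ (k - Suc i))"
      using that by (metis Suc_diff_Suc add_diff_inverse_nat less_imp_not_less power_Suc power_add)
    then have "m + d * M ^ k = m + M ^ i * (M * (d * M ^ (k - Suc i)))"
      by (simp add: ac_simps)
    then show ?thesis
      using assms by (simp only: digit_def) simp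
  qed
  moreover have "digit M k (m + d * M ^ k) = d"
    using assms by (simp add: digit_def)
  ultimately show ?thesis
    using assms by (simp add: base_shift_eq_sum_lessThan del: power_Suc)
qed

lemma sum_base_shift_eq_prod:
  "(\<Sum>m<M ^ k. monom (\<xi> ^ base_shift M N m) m)
    = (\<Prod>i<k. \<Sum>d<M. monom (\<xi> ^ (d * N ^ i)) (d * M ^ i) :: 'a::comm_semiring_1 poly)"
proof (induction k)
  case 0
  then show ?case
    by (simp add: base_shift_def digit_def monom_0 one_pCons)
next
  case (Suc k)
  let ?f = "\<lambda>m. monom (\<xi> ^ base_shift M N m) m"
  \<comment> \<open>The range is cut into blocks of length \<open>M ^ k\<close> by the leading digit
    \<open>d\<close>; each block turns out to be a monomial times the first one.\<close>
  have "sum ?f {..<M ^ Suc k} = (\<Sum>d<M. sum ?f {d * M ^ k..<d * M ^ k + M ^ k})"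
    by (simp add: sum.nat_group)
  also have "\<dots> = (\<Sum>d<M. \<Sum>m<M ^ k. ?f (m + d * M ^ k))"
    using sum.shift_bounds_nat_ivl[of ?f 0 "_ * M ^ k" "M ^ k"]
    by (simp add: add.commute lessThan_atLeast0)
  also have "\<dots> = (\<Sum>d<M. \<Sum>m<M ^ k. ?f m * monom (\<xi> ^ (d * N ^ k)) (d * M ^ k))"
    by (intro sum.cong refl) (simp add: base_shift_add_mult_power mult_monom power_add)
  also have "\<dots> = sum ?f {..<M ^ k} * (\<Sum>d<M. monom (\<xi> ^ (d * N ^ k)) (d * M ^ k))"
    by (subst sum.swap) (simp add: sum_product)
  finally show ?case
    by (simp add: Suc.IH)
qed

lemma sum_root_of_unity_powers_eq_0:
  fixes x :: "'a::field"
  assumes "x ^ n = 1" and "x \<noteq> 1"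
  shows "(\<Sum>d<n. x ^ d) = 0"
  using assms by (simp add: geometric_sum)

text \<open>By the product rule, a differentiation costs at most one power of the linear
  factor.\<close>

lemma linear_power_dvd_pderiv:
  fixes q :: "'a::idom poly"
  assumes "[:- a, 1:] ^ Suc n dvd q"
  shows "[:- a, 1:] ^ n dvd pderiv q"
proof -
  obtain r where "q = [:- a, 1:] ^ Suc n * r"
    using assms by (elim dvdE)
  then have "pderiv q = [:- a, 1:] ^ Suc n * pderiv r + r * pderiv ([:- a, 1:] ^ Suc n)"
    by (simp only: pderiv_mult)
  moreover have "[:- a, 1:] ^ n dvd [:- a, 1:] ^ Suc n * pderiv r"
    unfolding power_Suc2 mult.assoc by (rule dvd_triv_left)
  moreover have "[:- a, 1:] ^ n dvd r * pderiv ([:- a, 1:] ^ Suc n)"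
    unfolding pderiv_power_Suc by (intro dvd_mult dvd_mult2 dvd_smult dvd_refl)
  ultimately show ?thesis
    by (simp only: dvd_add)
qed

lemma higher_pderiv_eq_0_if_linear_power_dvd:
  fixes q :: "'a::idom poly"
  assumes "[:- a, 1:] ^ n dvd q" and "j < n"
  shows "poly ((pderiv ^^ j) q) a = 0"
proof -
  \<comment> \<open>Since \<open>j < n\<close>, at least one linear factor survives the
    \<open>j\<close> differentiations.\<close>
  have "[:- a, 1:] ^ (n - j) dvd (pderiv ^^ j) q"
    using assms(2)
  proof (induction j)
    case 0
    then show ?case
      using assms(1) by simp
  next
    case (Suc j)
    then have "[:- a, 1:] ^ Suc (n - Suc j) dvd (pderiv ^^ j) q"
      by (simp add: Suc_diff_Suc del: power_Suc)
    then show ?case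
      using linear_power_dvd_pderiv by simp
  qed
  moreover have "[:- a, 1:] dvd [:- a, 1:] ^ (n - j)"
    using assms(2) by (intro dvd_power) simp
  ultimately have "[:- a, 1:] dvd (pderiv ^^ j) q"
    by (rule dvd_trans[rotated])
  then show ?thesis
    by (simp add: poly_eq_0_iff_dvd)
qed

theorem theorem3p1:
  fixes M N p :: nat and \<xi> :: complex
  assumes "M \<ge> 2" and "N \<ge> 1"
    and "\<not> rad M dvd rad N"
    and "primitive_root_of_unity M \<xi>"
  shows "p + 1 \<le> order 1 (G_poly M N \<xi> p) \<and>
         (\<forall>j \<le> p. poly ((pderiv ^^ j) (G_poly M N \<xi> p)) 1 = 0)"
proof -
  let ?F = "\<lambda>i. \<Sum>d<M. monom (\<xi> ^ (d * N ^ i)) (d * M ^ i)"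
  have "[:- 1, 1:] dvd ?F i" for i
  proof -
    have "\<not> M dvd N ^ i"
      using assms rad_dvd_rad_if_dvd_power by blast
    then have "\<xi> ^ N ^ i \<noteq> 1"
      by (simp add: primitive_root_of_unity_power_eq_1_iff[OF assms(4)])
    moreover have "(\<xi> ^ N ^ i) ^ M = 1"
      unfolding power_mult[symmetric]
      by (simp add: primitive_root_of_unity_power_eq_1_iff[OF assms(4)])
    ultimately have "(\<Sum>d<M. (\<xi> ^ N ^ i) ^ d) = 0"
      by (rule sum_root_of_unity_powers_eq_0[rotated])
    \<comment> \<open>At 1 the powers of the variable become 1, which leaves exactly the geometric
      sum.\<close>
    then have "poly (?F i) 1 = 0"
      by (simp add: poly_sum poly_monom mult.commute flip: power_mult)
    then show ?thesis
      by (simp add: poly_eq_0_iff_dvd)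
  qed
  \<comment> \<open>Each of the \<open>p + 1\<close> factors contributes its own copy of the linear
    factor, so the multiplicities add up.\<close>
  then have "(\<Prod>i<p + 1. [:- 1, 1:]) dvd (\<Prod>i<p + 1. ?F i)"
    by (intro prod_dvd_prod)
  then have dvd: "[:- 1, 1:] ^ (p + 1) dvd G_poly M N \<xi> p"
    by (simp add: G_poly_def sum_base_shift_eq_prod del: power_Suc prod.lessThan_Suc)
  \<comment> \<open>\<open>order_divides\<close> leaves the zero polynomial as an alternative, which
    \<open>G_poly_nonzero\<close> excludes.\<close>
  then have "p + 1 \<le> order 1 (G_poly M N \<xi> p)"
    using G_poly_nonzero[OF assms(1)] by (simp only: order_divides) simp
  moreover have "poly ((pderiv ^^ j) (G_poly M N \<xi> p)) 1 = 0" if "j \<le> p" for j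
    using higher_pderiv_eq_0_if_linear_power_dvd[OF dvd, of j] that by simp
  ultimately show ?thesis
    by blast
qed

end
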